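(* Let $j,m\ge 1$ and $n,k\ge 0$ be integers. There is a bijection between the $k$-element subsets of $\mathbb{N}_n$ such that no two elements of the subset differ by an element of $\mathcal{Q}=\{m,2m,\ldots,jm\}$, and the permutations $\pi$ of $\mathbb{N}_{n+jm}$ that satisfy $\pi(i)-i\in\{-m,0,jm\}$ for all $i\in\mathbb{N}_{n+jm}$ and contain exactly $k$ excedances.
   Context: $\mathbb{N}_n=\{1,\ldots,n\}$ (empty for $n=0$). An excedance of a permutation $\pi$ is a position $i$ such that $\pi(i)>i$. *)

theory Defs
  imports Main "HOL-Combinatorics.Permutations"
begin

definition diff_set :: "nat \<Rightarrow> nat \<Rightarrow> nat set" where
  "diff_set j m = (\<lambda>i. i * m) ` {1..j}"

definition restricted_subsets :: "nat \<Rightarrow> nat set \<Rightarrow> nat \<Rightarrow> nat set set" where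
  "restricted_subsets n Q k =
     {S. S \<subseteq> {1..n} \<and> card S = k \<and> (\<forall>x\<in>S. \<forall>y\<in>S. x < y \<longrightarrow> y - x \<notin> Q)}"

definition excedances :: "nat \<Rightarrow> (nat \<Rightarrow> nat) \<Rightarrow> nat set" where
  "excedances N \<pi> = {i \<in> {1..N}. \<pi> i > i}"

definition restricted_perms :: "nat \<Rightarrow> int set \<Rightarrow> nat \<Rightarrow> (nat \<Rightarrow> nat) set" where
  "restricted_perms N D k =
     {\<pi>. \<pi> permutes {1..N} \<and> (\<forall>i\<in>{1..N}. int (\<pi> i) - int i \<in> D) \<and> card (excedances N \<pi>) = k}"

end

theory Submission
  imports Defs
begin

text \<open>
  The bijection sends a set \<open>S\<close> to the permutation that consists of the disjoint cycles
  \<open>s \<mapsto> s + j m \<mapsto> s + (j - 1) m \<mapsto> \<dots> \<mapsto> s + m \<mapsto> s\<close> for \<open>s \<in> S\<close>.  The condition on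
  differences says exactly that no element of \<open>S\<close> lies on the cycle of another one, and then
  two of these cycles never meet, so that they do define a permutation (\<open>cycles_inj\<close>).
  Its excedances are the elements of \<open>S\<close>, so the inverse map can only be \<open>excedances\<close>.

  It remains to see that every admissible permutation \<open>\<pi>\<close> is determined in this way by its set
  of excedances.  Cut the residue class of \<open>z\<close> modulo \<open>m\<close> just above \<open>z\<close>.  As many elements
  cross the cut upwards as downwards under \<open>\<pi>\<close>.  The only possible downward crossing is
  \<open>z + m \<mapsto> z\<close>, and the upward crossings come from the excedances among
  \<open>z, z - m, \<dots>, z - (j - 1) m\<close>.  Hence \<open>y = z + m\<close> is moved down if and only if one of
  \<open>y - m, \<dots>, y - j m\<close> is an excedance (\<open>descends_iff_after_excedance\<close>).  This one equivalence
  gives both the difference condition on the excedances, as an excedance is not moved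
  down, and the formula for \<open>\<pi>\<close> in terms of them.
\<close>

text \<open>
  The elements that follow \<open>S\<close> are those that lie on the cycle of some \<open>s \<in> S\<close> above \<open>s\<close>; the
  permutation moves them down.
\<close>

definition follows :: "nat \<Rightarrow> nat \<Rightarrow> nat set \<Rightarrow> nat \<Rightarrow> bool" where
  "follows j m S y \<longleftrightarrow> (\<exists>s\<in>S. \<exists>i\<in>{1..j}. y = s + i * m)"

definition cycles :: "nat \<Rightarrow> nat \<Rightarrow> nat set \<Rightarrow> nat \<Rightarrow> nat" where
  "cycles j m S y =
     (if y \<in> S then y + j * m else if follows j m S y then y - m else y)"

lemma restricted_subset_not_follows:
  assumes "S \<in> restricted_subsets n (diff_set j m) k" "m \<ge> 1" "y \<in> S"
  shows "\<not> follows j m S y"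
proof
  assume "follows j m S y"
  then obtain s i where si: "s \<in> S" "i \<in> {1..j}" "y = s + i * m"
    by (auto simp: follows_def)
  have "s < y" "y - s \<in> diff_set j m"
    using si assms(2) by (auto simp: diff_set_def)
  with assms si(1) show False
    by (auto simp: restricted_subsets_def)
qed

text \<open>
  The only collision that the disjointness assumption does not exclude at once is that of the jump
  \<open>x \<mapsto> x + j m\<close> with a descent \<open>y \<mapsto> y - m\<close>, where \<open>y = s + i m\<close>.  It would put \<open>s\<close> at distance
  \<open>(j + 1 - i) m\<close> above \<open>x\<close>, hence on the cycle of \<open>x\<close>.
\<close>

lemma cycles_inj:
  assumes disj: "\<And>y. y \<in> S \<Longrightarrow> \<not> follows j m S y" and j: "j \<ge> 1"
  shows "inj (cycles j m S)"
proof -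
  have follows_ge: "m \<le> y" if "follows j m S y" for y
    using that by (auto simp: follows_def trans_le_add2)
  have no_jump_down: "x + j * m \<noteq> y - m" if xy: "x \<in> S" "follows j m S y" for x y
  proof
    assume eq: "x + j * m = y - m"
    obtain s i where si: "s \<in> S" "i \<in> {1..j}" "y = s + i * m"
      using xy(2) by (auto simp: follows_def)
    have "x + j * m + m = s + i * m"
      using eq follows_ge[OF xy(2)] si by simp
    moreover have "j * m + m = (j + 1 - i) * m + i * m"
      using si(2) by (simp flip: add_mult_distrib)
    ultimately have "s = x + (j + 1 - i) * m" by simp
    moreover have "j + 1 - i \<in> {1..j}" using si(2) by auto
    ultimately have "follows j m S s"
      unfolding follows_def using xy(1) by blast
    with disj si(1) show False by blast
  qed
  have no_jump_fixed: "follows j m S (x + j * m)" if "x \<in> S" for x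
    using that j unfolding follows_def by (intro bexI[of _ x] bexI[of _ j]) auto
  have no_down_fixed: "y - m \<in> S \<or> follows j m S (y - m)" if y: "follows j m S y" for y
  proof -
    obtain s i where si: "s \<in> S" "i \<in> {1..j}" "y = s + i * m"
      using y by (auto simp: follows_def)
    then obtain l where l: "i = Suc l" by (cases i) auto
    then have "y - m = s + l * m" using si by simp
    moreover have "l = 0 \<or> l \<in> {1..j}" using si l by auto
    ultimately show ?thesis
      using si(1) unfolding follows_def by fastforce
  qed
  show ?thesis
  proof (rule injI)
    fix x y assume eq: "cycles j m S x = cycles j m S y"
    show "x = y"
      using eq disj no_jump_down[of x y] no_jump_down[of y x] no_jump_fixed[of x] no_jump_fixed[of y]
        no_down_fixed[of x] no_down_fixed[of y] follows_ge[of x] follows_ge[of y]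
      unfolding cycles_def by (auto split: if_splits)
  qed
qed

lemma excedances_cycles:
  assumes "S \<subseteq> {1..n}" "n \<le> N" "j \<ge> 1" "m \<ge> 1"
  shows "excedances N (cycles j m S) = S"
  using assms by (auto simp: excedances_def cycles_def split: if_splits)

lemma cycles_in_restricted_perms:
  assumes S: "S \<in> restricted_subsets n (diff_set j m) k" and j: "j \<ge> 1" and m: "m \<ge> 1"
  shows "cycles j m S \<in> restricted_perms (n + j * m) {- int m, 0, int (j * m)} k"
proof -
  let ?N = "n + j * m"
  have sub: "S \<subseteq> {1..n}" and card: "card S = k"
    using S by (auto simp: restricted_subsets_def)
  have follows_range: "m < y \<and> y \<le> ?N" if y: "follows j m S y" for y
  proof -
    obtain s i where si: "s \<in> S" "i \<in> {1..j}" "y = s + i * m"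
      using y by (auto simp: follows_def)
    have "i * m \<le> j * m" "1 * m \<le> i * m"
      using si(2) by (intro mult_le_mono1; simp)+
    moreover have "1 \<le> s" "s \<le> n" using si(1) sub by auto
    ultimately show ?thesis using si(3) by linarith
  qed
  have inj: "inj (cycles j m S)"
    using cycles_inj restricted_subset_not_follows[OF S m] j by blast
  have outside: "cycles j m S y = y" if "y \<notin> {1..?N}" for y
  proof -
    have "y \<notin> S" using that sub by auto
    moreover have "\<not> follows j m S y" using follows_range[of y] that by auto
    ultimately show ?thesis by (simp add: cycles_def)
  qed
  have into: "cycles j m S ` {1..?N} \<subseteq> {1..?N}"
    using sub follows_range by (force simp: cycles_def)
  have "cycles j m S permutes {1..?N}"
  proof (rule bij_imp_permutes[OF _ outside])
    show "bij_betw (cycles j m S) {1..?N} {1..?N}"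
      unfolding bij_betw_def
      using into inj by (meson endo_inj_surj finite_atLeastAtMost inj_on_subset subset_UNIV)
  qed
  moreover have "int (cycles j m S i) - int i \<in> {- int m, 0, int (j * m)}" for i
    using follows_range[of i] by (auto simp: cycles_def)
  ultimately show ?thesis
    using excedances_cycles[OF sub _ j m, of ?N] card by (simp add: restricted_perms_def)
qed

text \<open>
  The crossing argument: a finite set is mapped into itself by an injection if and only if it is
  covered by its image.  For the set \<open>A z\<close> of the positive elements among
  \<open>z, z - m, z - 2 m, \<dots>\<close>, not being mapped into itself means an upward crossing, and not
  being covered means the downward crossing \<open>z + m \<mapsto> z\<close>.
\<close>

lemma descends_iff_after_excedance:
  assumes perm: "\<pi> permutes {1..N}"
    and disp: "\<And>i. i \<in> {1..N} \<Longrightarrow> int (\<pi> i) - int i \<in> {- int m, 0, int (j * m)}"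
    and m: "m \<ge> 1" and y: "y \<in> {1..N}"
  shows "\<pi> y + m = y \<longleftrightarrow> follows j m (excedances N \<pi>) y"
proof -
  define A where "A z = {a \<in> {1..z}. \<exists>c. z = a + c * m}" for z
  have disp': "\<pi> i + m = i \<or> \<pi> i = i \<or> \<pi> i = i + j * m" if "i \<in> {1..N}" for i
    using disp[OF that] by (auto simp del: of_nat_mult)
  have A_cover: "\<pi> ` A z \<subseteq> A z \<longleftrightarrow> A z \<subseteq> \<pi> ` A z" for z
  proof -
    have fin: "finite (A z)" by (simp add: A_def)
    have "card (\<pi> ` A z) = card (A z)"
      using permutes_inj_on[OF perm] by (rule card_image)
    then show ?thesis
      using fin by (metis card_subset_eq finite_imageI order_refl)
  qed
  have A_sub: "a \<in> {1..N}" if "a \<in> A z" "z \<le> N" for a z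
    using that by (auto simp: A_def)
  have pos: "1 \<le> \<pi> i" if "i \<in> {1..N}" for i
    using permutes_in_image[OF perm, of i] that by auto
  show ?thesis
  proof
    assume desc: "\<pi> y + m = y"
    define z where "z = \<pi> y"
    have z: "1 \<le> z" "z + m = y" "z \<le> N" using desc pos[OF y] y by (auto simp: z_def)
    have "z \<in> A z" using z by (auto simp: A_def intro: exI[of _ 0])
    moreover have "y \<notin> A z" using z m by (auto simp: A_def)
    then have "z \<notin> \<pi> ` A z"
      using permutes_inj[OF perm] by (auto simp: z_def dest: injD)
    ultimately obtain x where x: "x \<in> A z" "\<pi> x \<notin> A z"
      using A_cover[of z] by blast
    have xN: "x \<in> {1..N}" using A_sub x z by blast
    obtain c where c: "z = x + c * m" using x by (auto simp: A_def)
    have "\<pi> x + m \<noteq> x"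
    proof
      assume "\<pi> x + m = x"
      then have "\<pi> x \<le> z" "z = \<pi> x + Suc c * m" using c by auto
      then have "\<pi> x \<in> A z" using pos[OF xN] unfolding A_def by fastforce
      with x show False by blast
    qed
    moreover have "\<pi> x \<noteq> x" using x by auto
    ultimately have up: "\<pi> x = x + j * m" using disp'[OF xN] by blast
    have "c < j"
    proof (rule ccontr)
      assume "\<not> c < j"
      then have "c * m = j * m + (c - j) * m" by (simp flip: add_mult_distrib)
      then have "z = \<pi> x + (c - j) * m" using c up by simp
      then have "\<pi> x \<in> A z" using pos[OF xN] by (auto simp: A_def)
      with x show False by blast
    qed
    then have "Suc c \<in> {1..j}" "y = x + Suc c * m" using c z by auto
    moreover have "x \<in> excedances N \<pi>"
      using \<open>\<pi> x \<noteq> x\<close> up xN by (auto simp: excedances_def)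
    ultimately show "follows j m (excedances N \<pi>) y"
      unfolding follows_def by blast
  next
    assume "follows j m (excedances N \<pi>) y"
    then obtain x i where x: "x \<in> {1..N}" "\<pi> x > x" and i: "i \<in> {1..j}" "y = x + i * m"
      by (auto simp: follows_def excedances_def)
    obtain l where l: "i = Suc l" using i by (cases i) auto
    define z where "z = x + l * m"
    have z: "z + m = y" "z \<le> N" using i l y by (auto simp: z_def)
    have "\<pi> x = x + j * m" using disp'[OF x(1)] x(2) by auto
    moreover have "l * m < j * m" using i l m by auto
    ultimately have "\<pi> x \<notin> A z" by (auto simp: A_def z_def)
    moreover have "x \<in> A z" using x by (auto simp: A_def z_def)
    ultimately obtain a where a: "a \<in> A z" "a \<notin> \<pi> ` A z"
      using A_cover[of z] by blast
    have aN: "a \<in> {1..N}" using A_sub a z by blast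
    then obtain p where p: "p \<in> {1..N}" "\<pi> p = a"
      using permutes_image[OF perm] by (metis imageE)
    have pA: "p \<notin> A z" using a p by auto
    obtain c where c: "z = a + c * m" using a by (auto simp: A_def)
    have "\<pi> p \<noteq> p + j * m"
    proof
      assume "\<pi> p = p + j * m"
      then have "z = p + (j + c) * m" using p c by (simp add: add_mult_distrib)
      then have "p \<in> A z" using p(1) unfolding A_def by auto
      with pA show False by blast
    qed
    then have pa: "p = a + m" using disp'[OF p(1)] p a pA by auto
    \<comment> \<open>The preimage \<open>a + m\<close> of \<open>a\<close> lies above the cut, so \<open>a\<close> is the element just below it.\<close>
    have "c = 0"
    proof (rule ccontr)
      assume "c \<noteq> 0"
      then obtain d where "c = Suc d" by (cases c) auto
      then have "z = p + d * m" using c pa by simp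
      then have "p \<in> A z" using p(1) unfolding A_def by auto
      with pA show False by blast
    qed
    then have "p = y" using c pa z by simp
    then show "\<pi> y + m = y" using pa p by simp
  qed
qed

lemma excedances_in_restricted_subsets:
  assumes perm: "\<pi> \<in> restricted_perms (n + j * m) {- int m, 0, int (j * m)} k"
    and m: "m \<ge> 1"
  shows "excedances (n + j * m) \<pi> \<in> restricted_subsets n (diff_set j m) k"
proof -
  let ?N = "n + j * m"
  have p: "\<pi> permutes {1..?N}" and card: "card (excedances ?N \<pi>) = k"
    and disp: "\<And>i. i \<in> {1..?N} \<Longrightarrow> int (\<pi> i) - int i \<in> {- int m, 0, int (j * m)}"
    using perm unfolding restricted_perms_def by blast+
  have "excedances ?N \<pi> \<subseteq> {1..n}"
  proof
    fix x assume x: "x \<in> excedances ?N \<pi>"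
    then have xN: "x \<in> {1..?N}" and gt: "\<pi> x > x" by (auto simp: excedances_def)
    have "\<pi> x = x + j * m" using disp[OF xN] gt by (auto simp del: of_nat_mult)
    moreover have "\<pi> x \<in> {1..?N}" using permutes_in_image[OF p] xN by blast
    ultimately show "x \<in> {1..n}" using xN by auto
  qed
  moreover have "y - x \<notin> diff_set j m"
    if xy: "x \<in> excedances ?N \<pi>" "y \<in> excedances ?N \<pi>" "x < y" for x y
  proof
    assume "y - x \<in> diff_set j m"
    then obtain i where "i \<in> {1..j}" "y = x + i * m"
      using xy(3) unfolding diff_set_def
      by (metis imageE le_add_diff_inverse less_imp_le)
    then have "follows j m (excedances ?N \<pi>) y"
      using xy(1) unfolding follows_def by blast
    moreover have "y \<in> {1..?N}" "\<pi> y > y" using xy(2) by (auto simp: excedances_def)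
    ultimately show False
      using descends_iff_after_excedance[OF p disp m, of y] by simp
  qed
  ultimately show ?thesis
    using card by (simp add: restricted_subsets_def)
qed

lemma cycles_excedances:
  assumes perm: "\<pi> \<in> restricted_perms (n + j * m) {- int m, 0, int (j * m)} k"
    and j: "j \<ge> 1" and m: "m \<ge> 1"
  shows "cycles j m (excedances (n + j * m) \<pi>) = \<pi>"
proof
  fix y
  let ?N = "n + j * m"
  let ?E = "excedances ?N \<pi>"
  have p: "\<pi> permutes {1..?N}"
    and disp: "\<And>i. i \<in> {1..?N} \<Longrightarrow> int (\<pi> i) - int i \<in> {- int m, 0, int (j * m)}"
    using perm unfolding restricted_perms_def by blast+
  show "cycles j m ?E y = \<pi> y"
  proof (cases "y \<in> {1..?N}")
    case True
    have E: "y \<in> ?E \<longleftrightarrow> \<pi> y > y" using True by (simp add: excedances_def)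
    have F: "follows j m ?E y \<longleftrightarrow> \<pi> y + m = y"
      using descends_iff_after_excedance[OF p disp m True] by simp
    show ?thesis
      using disp[OF True] m j unfolding cycles_def E F by (auto simp del: of_nat_mult)
  next
    case False
    have "cycles j m ?E permutes {1..?N}"
      using cycles_in_restricted_perms[OF excedances_in_restricted_subsets[OF perm m] j m]
      by (simp add: restricted_perms_def)
    then show ?thesis
      using False p by (metis permutes_not_in)
  qed
qed

theorem theorem13:
  fixes j m n k :: nat
  assumes "j \<ge> 1" and "m \<ge> 1"
  shows "\<exists>f. bij_betw f (restricted_subsets n (diff_set j m) k)
               (restricted_perms (n + j * m) {- int m, 0, int (j * m)} k)"
proof (intro exI bij_betw_byWitness[where f' = "excedances (n + j * m)"])
  show "\<forall>S \<in> restricted_subsets n (diff_set j m) k.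
      excedances (n + j * m) (cycles j m S) = S"
    using excedances_cycles assms by (auto simp: restricted_subsets_def)
qed (use assms cycles_excedances cycles_in_restricted_perms
      excedances_in_restricted_subsets in blast)+

end
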